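(* Let $n$ and $m$ be positive integers with $m < (n+1)/2$, and let $v_0, v_1, \dots, v_n$ be independent, square-integrable real random variables with mean zero. Put $\Delta v_k = v_k - v_{k-1}$ for $k=1,\dots,n$ and $$p^n_{k,l} = \sqrt{\frac{2}{n+\frac12}}\,\cos\left(\left(l-\tfrac12\right)\pi\,\frac{k-\frac12}{n+\frac12}\right),\qquad k,l=1,\dots,n.$$ Then $$\mathbf{E}\left[\frac{n}{m}\sum_{l=1}^{m}\left(\sum_{k=1}^{n} p^n_{k,l}\,\Delta v_k\right)^2\right] \ \ge\ \frac12\,\mathbf{E}[v_0^2].$$
   Context: The random variables $v_k$ model the additive micro-structure noise in the observations $Y_{k}=X_{k}+v_k$, $k=0,1,\dots,n$, of an Itô process $X$; $v_0$ is the noise in the initial observation. $\mathbf{E}$ denotes expectation. *)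

theory Defs
  imports "HOL-Probability.Probability"
begin

definition increment :: "(nat \<Rightarrow> 'a \<Rightarrow> real) \<Rightarrow> nat \<Rightarrow> 'a \<Rightarrow> real" where
  "increment v k \<omega> = v k \<omega> - v (k - 1) \<omega>"  (* only meaningful for k \<ge> 1: natural subtraction *)

definition p_coeff :: "nat \<Rightarrow> nat \<Rightarrow> nat \<Rightarrow> real" where
  "p_coeff n k l =
     sqrt (2 / (real n + 1/2)) * cos ((real l - 1/2) * pi * ((real k - 1/2) / (real n + 1/2)))"

end

theory Submission
  imports Defs
begin

text \<open>
  The noise \<open>v 0\<close> enters the weighted sum of increments only through the first increment, so
  summation by parts turns \<open>\<Sum>k=1..n. p k * (v k - v (k - 1))\<close> into a linear combination of
  \<open>v 0, \<dots>, v n\<close> in which \<open>v 0\<close> has the coefficient \<open>- p 1\<close>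
  (lemma \<open>weighted_sum_of_differences\<close>). Being independent and centered, the \<open>v k\<close> are orthogonal in
  \<open>L\<^sup>2\<close>, so the expected square of this combination is the sum of the contributions of the single variables
  (lemma \<open>expectation_square_linear_combination\<close>); all of these are nonnegative, and that of
  \<open>v 0\<close> is \<open>(p 1)\<^sup>2\<close> times the second moment of \<open>v 0\<close>.

  For the frequencies \<open>l\<close> up to \<open>(n + 1) / 2\<close> the angle in \<open>p_coeff n 1 l\<close> stays within the first
  eighth of the circle, so its squared cosine is at least \<open>1/2\<close> and \<open>(p_coeff n 1 l)\<^sup>2\<close> is at least
  \<open>1 / (n + 1/2)\<close> (lemma \<open>p_coeff_first_row_lower_bound\<close>). Averaging over \<open>l\<close> and multiplying by
  \<open>n\<close> gives the factor \<open>n / (n + 1/2)\<close>, which is at least \<open>2/3\<close>.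
\<close>

lemma (in prob_space) indep_vars_centered_mult:
  fixes X :: "'i \<Rightarrow> 'a \<Rightarrow> real"
  assumes "indep_vars (\<lambda>_. borel) X I" "i \<in> I" "j \<in> I" "i \<noteq> j"
    and "integrable M (X i)" "integrable M (X j)" "expectation (X i) = 0"
  shows "integrable M (\<lambda>\<omega>. X i \<omega> * X j \<omega>)" "expectation (\<lambda>\<omega>. X i \<omega> * X j \<omega>) = 0"
proof -
  have ind: "indep_vars (\<lambda>_. borel) X {i, j}"
    by (rule indep_vars_subset[OF assms(1)]) (use assms in auto)
  have int: "integrable M (X k)" if "k \<in> {i, j}" for k
    using that assms by auto
  show "integrable M (\<lambda>\<omega>. X i \<omega> * X j \<omega>)"
    using indep_vars_integrable[OF _ ind int] \<open>i \<noteq> j\<close> by simp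
  show "expectation (\<lambda>\<omega>. X i \<omega> * X j \<omega>) = 0"
    using indep_vars_lebesgue_integral[OF _ ind int] assms(4,7) by simp
qed

text \<open>
  Expanding the square gives a double sum over \<open>I\<close> whose off-diagonal terms are integrable with
  expectation zero, by independence and centering; only the diagonal survives.
\<close>
lemma (in prob_space) expectation_square_linear_combination:
  fixes X :: "'i \<Rightarrow> 'a \<Rightarrow> real" and c :: "'i \<Rightarrow> real"
  assumes I: "finite I" and ind: "indep_vars (\<lambda>_. borel) X I"
    and sq: "\<And>i. i \<in> I \<Longrightarrow> integrable M (\<lambda>\<omega>. (X i \<omega>)\<^sup>2)"
    and centered: "\<And>i. i \<in> I \<Longrightarrow> expectation (X i) = 0"
  shows "integrable M (\<lambda>\<omega>. (\<Sum>i\<in>I. c i * X i \<omega>)\<^sup>2)"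
    and "expectation (\<lambda>\<omega>. (\<Sum>i\<in>I. c i * X i \<omega>)\<^sup>2)
           = (\<Sum>i\<in>I. (c i)\<^sup>2 * expectation (\<lambda>\<omega>. (X i \<omega>)\<^sup>2))"
proof -
  have "X i \<in> borel_measurable M" if "i \<in> I" for i
    using ind that by (auto simp: indep_vars_def)
  then have int: "integrable M (X i)" if "i \<in> I" for i
    using square_integrable_imp_integrable sq that by blast
  have prod_int: "integrable M (\<lambda>\<omega>. X i \<omega> * X j \<omega>)" if "i \<in> I" "j \<in> I" for i j
    using that sq[of i] indep_vars_centered_mult(1)[OF ind that _ int int] centered
    by (cases "i = j") (auto simp: power2_eq_square)
  have prod_exp: "expectation (\<lambda>\<omega>. X i \<omega> * X j \<omega>)
      = (if i = j then expectation (\<lambda>\<omega>. (X i \<omega>)\<^sup>2) else 0)" if "i \<in> I" "j \<in> I" for i j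
    using that indep_vars_centered_mult(2)[OF ind that _ int int] centered
    by (cases "i = j") (auto simp: power2_eq_square)
  have expand: "(\<Sum>i\<in>I. c i * X i \<omega>)\<^sup>2 = (\<Sum>i\<in>I. \<Sum>j\<in>I. c i * c j * (X i \<omega> * X j \<omega>))" for \<omega>
    by (simp add: power2_eq_square sum_product mult_ac)
  show "integrable M (\<lambda>\<omega>. (\<Sum>i\<in>I. c i * X i \<omega>)\<^sup>2)"
    unfolding expand using prod_int by (intro Bochner_Integration.integrable_sum) auto
  have "expectation (\<lambda>\<omega>. (\<Sum>i\<in>I. c i * X i \<omega>)\<^sup>2)
      = (\<Sum>i\<in>I. \<Sum>j\<in>I. c i * c j * expectation (\<lambda>\<omega>. X i \<omega> * X j \<omega>))"
    unfolding expand using prod_int by (simp add: Bochner_Integration.integral_sum)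
  also have "\<dots> = (\<Sum>i\<in>I. \<Sum>j\<in>I. if i = j then (c i)\<^sup>2 * expectation (\<lambda>\<omega>. (X i \<omega>)\<^sup>2) else 0)"
    by (intro sum.cong refl) (simp add: prod_exp power2_eq_square[of "c _"])
  also have "\<dots> = (\<Sum>i\<in>I. (c i)\<^sup>2 * expectation (\<lambda>\<omega>. (X i \<omega>)\<^sup>2))"
    using I by simp
  finally show "expectation (\<lambda>\<omega>. (\<Sum>i\<in>I. c i * X i \<omega>)\<^sup>2)
           = (\<Sum>i\<in>I. (c i)\<^sup>2 * expectation (\<lambda>\<omega>. (X i \<omega>)\<^sup>2))" .
qed

text \<open>
  Summation by parts, with the coefficient of each \<open>x k\<close> collected: \<open>x k\<close> is the end of the
  \<open>k\<close>-th difference (if there is one) and the start of the next one (if there is one).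
\<close>
lemma weighted_sum_of_differences:
  fixes p x :: "nat \<Rightarrow> 'r::ring"
  shows "(\<Sum>k=1..n. p k * (x k - x (k - 1)))
    = (\<Sum>k\<in>{0..n}. ((if k = 0 then 0 else p k) - (if k = n then 0 else p (Suc k))) * x k)"
proof -
  have ends: "(\<Sum>k\<in>{0..n}. (if k = 0 then 0 else p k) * x k) = (\<Sum>k=1..n. p k * x k)"
    by (rule sum.mono_neutral_cong_right) auto
  have "(\<Sum>k\<in>{0..n}. (if k = n then 0 else p (Suc k)) * x k) = (\<Sum>k<n. p (Suc k) * x k)"
    by (rule sum.mono_neutral_cong_right) auto
  also have "\<dots> = (\<Sum>k=1..n. p k * x (k - 1))"
    by (rule sum.reindex_bij_witness[of _ "\<lambda>k. k - 1" Suc]) auto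
  finally have starts: "(\<Sum>k\<in>{0..n}. (if k = n then 0 else p (Suc k)) * x k)
      = (\<Sum>k=1..n. p k * x (k - 1))" .
  show ?thesis
    by (simp only: left_diff_distrib right_diff_distrib sum_subtractf ends starts)
qed

lemma (in prob_space) expectation_square_weighted_increments:
  fixes v :: "nat \<Rightarrow> 'a \<Rightarrow> real" and p :: "nat \<Rightarrow> real"
  assumes "n \<ge> 1" and ind: "indep_vars (\<lambda>_. borel) v {0..n}"
    and sq: "\<And>k. k \<le> n \<Longrightarrow> integrable M (\<lambda>\<omega>. (v k \<omega>)\<^sup>2)"
    and centered: "\<And>k. k \<le> n \<Longrightarrow> expectation (v k) = 0"
  shows "integrable M (\<lambda>\<omega>. (\<Sum>k=1..n. p k * increment v k \<omega>)\<^sup>2)"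
    and "(p 1)\<^sup>2 * expectation (\<lambda>\<omega>. (v 0 \<omega>)\<^sup>2)
           \<le> expectation (\<lambda>\<omega>. (\<Sum>k=1..n. p k * increment v k \<omega>)\<^sup>2)"
proof -
  define c where "c k = (if k = 0 then 0 else p k) - (if k = n then 0 else p (Suc k))" for k
  have eq: "(\<Sum>k=1..n. p k * increment v k \<omega>) = (\<Sum>k\<in>{0..n}. c k * v k \<omega>)" for \<omega>
    using weighted_sum_of_differences[of p "\<lambda>k. v k \<omega>" n]
    unfolding increment_def c_def .
  note square = expectation_square_linear_combination[OF finite_atLeastAtMost ind, of c]
  show "integrable M (\<lambda>\<omega>. (\<Sum>k=1..n. p k * increment v k \<omega>)\<^sup>2)"
    unfolding eq using square(1) sq centered by simp
  have "(c 0)\<^sup>2 * expectation (\<lambda>\<omega>. (v 0 \<omega>)\<^sup>2)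
      \<le> (\<Sum>k\<in>{0..n}. (c k)\<^sup>2 * expectation (\<lambda>\<omega>. (v k \<omega>)\<^sup>2))"
    by (rule member_le_sum) auto
  also have "\<dots> = expectation (\<lambda>\<omega>. (\<Sum>k=1..n. p k * increment v k \<omega>)\<^sup>2)"
    unfolding eq using square(2) sq centered by simp
  finally show "(p 1)\<^sup>2 * expectation (\<lambda>\<omega>. (v 0 \<omega>)\<^sup>2)
      \<le> expectation (\<lambda>\<omega>. (\<Sum>k=1..n. p k * increment v k \<omega>)\<^sup>2)"
    using \<open>n \<ge> 1\<close> by (simp add: c_def)
qed

text \<open>
  The angle is \<open>(l - 1/2) * pi / (2 * n + 1)\<close>, and the upper bound on \<open>l\<close> keeps it below \<open>pi / 4\<close>.
\<close>
lemma p_coeff_first_row_lower_bound: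
  assumes "l \<ge> 1" "2 * l \<le> n + 1"
  shows "1 / (real n + 1/2) \<le> (p_coeff n 1 l)\<^sup>2"
proof -
  define \<theta> where "\<theta> = (real l - 1/2) * pi * ((real 1 - 1/2) / (real n + 1/2))"
  have \<theta>: "\<theta> = pi * ((real l - 1/2) / (2 * real n + 1))"
    by (simp add: \<theta>_def field_simps)
  have "(real l - 1/2) / (2 * real n + 1) \<le> 1/4"
    using assms by (simp add: field_simps)
  then have "\<theta> \<le> pi * (1/4)"
    unfolding \<theta> by (intro mult_left_mono) auto
  moreover have "0 \<le> \<theta>"
    using assms unfolding \<theta> by simp
  ultimately have "cos (pi / 4) \<le> cos \<theta>"
    using pi_gt_zero by (intro cos_monotone_0_pi_le) linarith+
  then have "(sqrt 2 / 2)\<^sup>2 \<le> (cos \<theta>)\<^sup>2"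
    by (intro power_mono) (auto simp: cos_45)
  then have cos: "1/2 \<le> (cos \<theta>)\<^sup>2"
    by (simp add: power_divide)
  have "(p_coeff n 1 l)\<^sup>2 = 2 / (real n + 1/2) * (cos \<theta>)\<^sup>2"
    unfolding p_coeff_def \<theta>_def[symmetric] by (simp add: power_mult_distrib)
  moreover have "1 / (real n + 1/2) \<le> 2 / (real n + 1/2) * (cos \<theta>)\<^sup>2"
    using cos by (simp add: divide_right_mono)
  ultimately show ?thesis by simp
qed

theorem proposition2p3:
  fixes M :: "'a measure" and v :: "nat \<Rightarrow> 'a \<Rightarrow> real" and n m :: nat
  assumes "prob_space M"
    and "n \<ge> 1" and "m \<ge> 1" and "real m < (real n + 1) / 2"
    and "prob_space.indep_vars M (\<lambda>_. borel) v {0..n}"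
    and "\<And>k. k \<le> n \<Longrightarrow> integrable M (\<lambda>\<omega>. (v k \<omega>)\<^sup>2)"
    and "\<And>k. k \<le> n \<Longrightarrow> prob_space.expectation M (v k) = 0"
  shows "prob_space.expectation M
           (\<lambda>\<omega>. real n / real m *
              (\<Sum>l=1..m. (\<Sum>k=1..n. p_coeff n k l * increment v k \<omega>)\<^sup>2))
         \<ge> 1/2 * prob_space.expectation M (\<lambda>\<omega>. (v 0 \<omega>)\<^sup>2)"
proof -
  interpret prob_space M by fact
  define S where "S l \<omega> = (\<Sum>k=1..n. p_coeff n k l * increment v k \<omega>)\<^sup>2" for l \<omega>
  define V where "V = expectation (\<lambda>\<omega>. (v 0 \<omega>)\<^sup>2)"
  have V: "0 \<le> V" unfolding V_def by simp
  note increments = expectation_square_weighted_increments[OF assms(2,5,6,7)]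
  have S_int: "integrable M (S l)" for l
    unfolding S_def using increments(1) by simp
  have S_lower: "V / (real n + 1/2) \<le> expectation (S l)" if "l \<in> {1..m}" for l
  proof -
    have "1 / (real n + 1/2) \<le> (p_coeff n 1 l)\<^sup>2"
      using that assms(4) by (intro p_coeff_first_row_lower_bound) auto
    then have "1 / (real n + 1/2) * V \<le> (p_coeff n 1 l)\<^sup>2 * V"
      using V by (rule mult_right_mono)
    also have "\<dots> \<le> expectation (S l)"
      unfolding S_def V_def using increments(2)[of "\<lambda>k. p_coeff n k l"] by simp
    finally show ?thesis by simp
  qed
  have "1/2 * V \<le> real n / (real n + 1/2) * V"
    using \<open>n \<ge> 1\<close> V by (intro mult_right_mono) (auto simp: field_simps)
  also have "\<dots> = real n / real m * (\<Sum>l=1..m. V / (real n + 1/2))"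
    using \<open>m \<ge> 1\<close> by simp
  also have "\<dots> \<le> real n / real m * (\<Sum>l=1..m. expectation (S l))"
    using S_lower by (intro mult_left_mono sum_mono) auto
  also have "\<dots> = expectation (\<lambda>\<omega>. real n / real m * (\<Sum>l=1..m. S l \<omega>))"
    using S_int by (simp add: Bochner_Integration.integral_sum)
  finally show ?thesis
    unfolding S_def V_def .
qed

end
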